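(* Let $p_1,\dots,p_m$ be independent $p$-values with set of true nulls $\mathcal H_0\subset\{1,\dots,m\}$, such that $p_i\sim U(0,1)$ for $i\in\mathcal H_0$, let $\pi$ be a deterministic permutation of $\{1,\dots,m\}$ and let $s\in(0,1]$. For all $\delta\in(0,1)$ and $\lambda\in[0,1)$, setting $$R_k=\{\pi(i):1\le i\le k,\ p_{\pi(i)}\le s\},\qquad \overline{\mathrm{FDP}}_k^{\mathrm{Freed}}=1\wedge\frac{\frac{s}{1-\lambda}\sum_{i=1}^k\mathbf 1\{p_{\pi(i)}>\lambda\}+\Delta(\nu k)}{\sum_{i=1}^k\mathbf 1\{p_{\pi(i)}\le s\}},\qquad k=1,\dots,m,$$ where $\Delta(u)=2\sqrt{\varepsilon_u}\sqrt{u\vee1}+\frac12\varepsilon_u$, $\varepsilon_u=\log((1+\kappa)/\delta)+2\log(1+\log_2(u\vee1))$ for $u>0$, $\kappa=\pi_\circ^2/6$ (with $\pi_\circ=3.14159\ldots$), and $\nu=s\bigl(1+\min(s,\lambda)/(1-\lambda)\bigr)$, one has $$\mathbf P\bigl(\forall k\in\{1,\dots,m\},\ \mathrm{FDP}(R_k)\le\overline{\mathrm{FDP}}_k^{\mathrm{Freed}}\bigr)\ge1-\delta.$$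
   Context: Pre-ordered setting: $p_1,\dots,p_m\in[0,1]$ independent, $\mathcal H_0$ a fixed subset of $\{1,\dots,m\}$, nothing assumed on the marginals of $p_i$ for $i\notin\mathcal H_0$. $\mathrm{FDP}(R)=|R\cap\mathcal H_0|/(|R|\vee1)$. When the denominator of $\overline{\mathrm{FDP}}_k^{\mathrm{Freed}}$ is zero, the ratio is read as $+\infty$, so that $\overline{\mathrm{FDP}}_k^{\mathrm{Freed}}=1$. *)

theory Defs
  imports "HOL-Probability.Probability" "HOL-Combinatorics.Permutations"
begin

definition FDP :: "nat set \<Rightarrow> nat set \<Rightarrow> real" where
  "FDP H0 R = real (card (R \<inter> H0)) / real (max (card R) 1)"

definition kappa :: real where
  "kappa = pi\<^sup>2 / 6"

definition eps :: "real \<Rightarrow> real \<Rightarrow> real" where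
  "eps \<delta> u = ln ((1 + kappa) / \<delta>) + 2 * ln (1 + log 2 (max u 1))"

definition Delta :: "real \<Rightarrow> real \<Rightarrow> real" where
  "Delta \<delta> u = 2 * sqrt (eps \<delta> u) * sqrt (max u 1) + eps \<delta> u / 2"

definition nu :: "real \<Rightarrow> real \<Rightarrow> real" where
  "nu s lam = s * (1 + min s lam / (1 - lam))"

text \<open>In the following, \<open>x i\<close> is the (realized) value of the \<open>i\<close>-th p-value
  and \<open>\<sigma>\<close> is the ordering permutation.\<close>

definition rej_set :: "(nat \<Rightarrow> nat) \<Rightarrow> real \<Rightarrow> (nat \<Rightarrow> real) \<Rightarrow> nat \<Rightarrow> nat set" where
  "rej_set \<sigma> s x k = {\<sigma> i | i. 1 \<le> i \<and> i \<le> k \<and> x (\<sigma> i) \<le> s}"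

text \<open>A ratio with zero denominator is read as \<open>+\<infinity>\<close>, so that the minimum with 1 is 1;
  the case distinction is needed because real division by zero yields 0.\<close>

definition FDP_Freed ::
  "(nat \<Rightarrow> nat) \<Rightarrow> real \<Rightarrow> real \<Rightarrow> real \<Rightarrow> (nat \<Rightarrow> real) \<Rightarrow> nat \<Rightarrow> real" where
  "FDP_Freed \<sigma> s \<delta> lam x k =
    (let N = s / (1 - lam) * (\<Sum>i=1..k. of_bool (x (\<sigma> i) > lam)) + Delta \<delta> (nu s lam * real k);
         D = (\<Sum>i=1..k. of_bool (x (\<sigma> i) \<le> s))
     in if D = 0 then 1 else min 1 (N / D))"

end

theory Submission
  imports Defs
begin

text \<open>
  Over the true nulls, the increments \<open>1{p \<le> s} - s/(1-\<lambda>) 1{p > \<lambda>}\<close> are independent, centred,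
  bounded above by 1 and have second moment at most \<open>\<nu>\<close>; if their partial sums \<open>S\<^sub>k\<close> stay below
  \<open>\<Delta>(\<nu> k)\<close>, then the FDP bounds hold. For fixed \<open>t\<close>, the Bernstein-type bound
  \<open>exp y \<le> 1 + y + y\<^sup>2/(2-t)\<close> for \<open>y \<le> t < 2\<close> makes \<open>exp (t S\<^sub>k - k \<nu> t\<^sup>2/(2-t))\<close> a product
  of independent nonnegative factors of mean at most 1, to which the maximal inequality for
  nonnegative supermartingales applies (Markov's inequality for the product stopped on reaching the
  level). Optimising \<open>t\<close> separately on each dyadic range \<open>2\<^sup>j \<le> max (\<nu> k) 1 < 2\<^sup>j\<^sup>+\<^sup>1\<close> at level proportional
  to \<open>1/(1+j)\<^sup>2\<close> and summing over \<open>j\<close> yields the boundary \<open>\<Delta>\<close>.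
\<close>

section \<open>The sub-gamma exponent\<close>

lemma exp_le_pade:
  fixes y :: real
  assumes "0 \<le> y" "y < 2"
  shows "exp y \<le> (2 + y) / (2 - y)"
proof -
  define f where "f z = ln (2 + z) - ln (2 - z) - z" for z :: real
  have "f 0 \<le> f y"
  proof (rule DERIV_nonneg_imp_nondecreasing[OF assms(1)])
    fix z assume z: "0 \<le> z" "z \<le> y"
    have "(f has_real_derivative (1 / (2 + z) + 1 / (2 - z) - 1)) (at z)"
      unfolding f_def using z assms by (auto intro!: derivative_eq_intros)
    moreover have "1 / (2 + z) + 1 / (2 - z) - 1 = z\<^sup>2 / ((2 + z) * (2 - z))"
      using z assms by (simp add: divide_simps) (simp add: algebra_simps power2_eq_square)
    moreover have "z\<^sup>2 / ((2 + z) * (2 - z)) \<ge> 0"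
      using z assms by simp
    ultimately show "\<exists>d. (f has_real_derivative d) (at z) \<and> 0 \<le> d" by metis
  qed
  hence "y \<le> ln ((2 + y) / (2 - y))"
    using assms by (simp add: f_def ln_div)
  thus ?thesis using assms by (subst (asm) ln_ge_iff) auto
qed

lemma exp_le_quadratic_nonpos:
  fixes y :: real
  assumes "y \<le> 0"
  shows "exp y \<le> 1 + y + y\<^sup>2 / 2"
proof -
  define g where "g z = 1 + z + z\<^sup>2 / 2 - exp z" for z :: real
  have "g 0 \<le> g y"
  proof (rule DERIV_nonpos_imp_nonincreasing[OF assms])
    fix z :: real
    have "(g has_real_derivative (1 + z - exp z)) (at z)"
      unfolding g_def by (auto intro!: derivative_eq_intros)
    moreover have "1 + z - exp z \<le> 0"
      using exp_ge_add_one_self[of z] by simp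
    ultimately show "\<exists>d. (g has_real_derivative d) (at z) \<and> d \<le> 0" by blast
  qed
  thus ?thesis by (simp add: g_def)
qed

lemma exp_le_quadratic:
  fixes c y :: real
  assumes "y \<le> c" "0 \<le> c" "c < 2"
  shows "exp y \<le> 1 + y + y\<^sup>2 / (2 - c)"
proof (cases "0 \<le> y")
  case True
  have "exp y \<le> (2 + y) / (2 - y)"
    using True assms by (intro exp_le_pade) auto
  also have "\<dots> = 1 + y + y\<^sup>2 / (2 - y)"
    using True assms by (simp add: field_simps power2_eq_square)
  also have "\<dots> \<le> 1 + y + y\<^sup>2 / (2 - c)"
    using True assms by (intro add_left_mono divide_left_mono) auto
  finally show ?thesis .
next
  case False
  have "exp y \<le> 1 + y + y\<^sup>2 / 2"
    using False by (intro exp_le_quadratic_nonpos) auto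
  also have "\<dots> \<le> 1 + y + y\<^sup>2 / (2 - c)"
    using assms by (intro add_left_mono divide_left_mono) auto
  finally show ?thesis .
qed

definition sub_gamma_psi :: "real \<Rightarrow> real \<Rightarrow> real" where
  "sub_gamma_psi b t = t\<^sup>2 / (2 - t * b)"

definition bernstein_radius :: "real \<Rightarrow> real \<Rightarrow> real \<Rightarrow> real" where
  "bernstein_radius b V x = sqrt (2 * V * x) + b * x / 2"

lemma sub_gamma_psi_nonneg: "t * b < 2 \<Longrightarrow> 0 \<le> sub_gamma_psi b t"
  by (simp add: sub_gamma_psi_def)

lemma bernstein_radius_attained:
  assumes "0 \<le> b" "0 < V" "0 < x"
  obtains t where "0 < t" "t * b < 2" "t * bernstein_radius b V x - V * sub_gamma_psi b t = x"
proof -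
  define r where "r = sqrt (2 * x / V)"
  \<comment> \<open>the maximiser of \<open>t * bernstein_radius b V x - V * sub_gamma_psi b t\<close>\<close>
  define t where "t = r / (1 + b * r / 2)"
  have r_pos: "0 < r" and r_squared: "r\<^sup>2 = 2 * x / V"
    using assms by (simp_all add: r_def)
  have denom: "0 < 1 + b * r / 2"
    using r_pos assms by (simp add: add_pos_nonneg)
  have t_pos: "0 < t"
    using r_pos denom by (simp add: t_def)
  have t_eq: "t + t * b * r / 2 = r"
  proof -
    have "t + t * b * r / 2 = t * (1 + b * r / 2)" by (simp add: algebra_simps)
    thus ?thesis using denom by (simp add: t_def)
  qed
  have slack: "2 - t * b = 2 / (1 + b * r / 2)"
    using denom by (simp add: t_def field_simps)
  have x_eq: "x = V * r\<^sup>2 / 2"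
    using assms r_squared by simp
  have radius: "bernstein_radius b V x = V * r + b * V * r\<^sup>2 / 4"
  proof -
    have "2 * V * x = (V * r)\<^sup>2"
      by (simp add: x_eq power2_eq_square)
    hence "sqrt (2 * V * x) = V * r"
      using assms r_pos by simp
    thus ?thesis by (simp add: bernstein_radius_def x_eq)
  qed
  have psi: "sub_gamma_psi b t = r * t / 2"
  proof -
    have "sub_gamma_psi b t = t * (t * (1 + b * r / 2)) / 2"
      by (simp add: sub_gamma_psi_def slack power2_eq_square)
    thus ?thesis using denom by (simp add: t_def)
  qed
  have "t * bernstein_radius b V x - V * sub_gamma_psi b t = V * r / 2 * (t + t * b * r / 2)"
    unfolding radius psi by (simp add: algebra_simps power2_eq_square)
  also have "\<dots> = x"
    unfolding t_eq by (simp add: x_eq power2_eq_square)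
  finally have "t * bernstein_radius b V x - V * sub_gamma_psi b t = x" .
  moreover have "t * b < 2"
    using slack denom by (smt (verit) divide_pos_pos)
  ultimately show thesis using t_pos that by blast
qed

section \<open>The maximal inequality for products of independent factors\<close>

fun stopped_prod :: "real \<Rightarrow> (nat \<Rightarrow> real) \<Rightarrow> nat \<Rightarrow> real" where
  "stopped_prod c y 0 = 1"
| "stopped_prod c y (Suc k) =
     (if stopped_prod c y k \<ge> c then stopped_prod c y k else stopped_prod c y k * y (Suc k))"

lemma stopped_prod_cong:
  "(\<And>i. i \<in> {1..k} \<Longrightarrow> y i = z i) \<Longrightarrow> stopped_prod c y k = stopped_prod c z k"
  by (induction k) auto

lemma stopped_prod_nonneg:
  "(\<And>i. i \<in> {1..k} \<Longrightarrow> 0 \<le> y i) \<Longrightarrow> 0 \<le> stopped_prod c y k"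
  by (induction k) auto

lemma stopped_prod_eq_prod:
  "stopped_prod c y k < c \<Longrightarrow> stopped_prod c y k = (\<Prod>i=1..k. y i)"
  by (induction k) (auto split: if_splits simp: mult.commute)

lemma stopped_prod_ge_mono:
  assumes "stopped_prod c y k \<ge> c" "k \<le> n"
  shows "stopped_prod c y n \<ge> c"
  using assms(2,1) by (induction rule: dec_induct) auto

lemma stopped_prod_ge_if_prod_ge:
  assumes "(\<Prod>i=1..k. y i) \<ge> c" "k \<le> n"
  shows "stopped_prod c y n \<ge> c"
  using assms stopped_prod_eq_prod stopped_prod_ge_mono not_le by metis

definition running_prod :: "real \<Rightarrow> (nat \<Rightarrow> real) \<Rightarrow> nat \<Rightarrow> real" where
  "running_prod c y k = (if stopped_prod c y k \<ge> c then 0 else stopped_prod c y k)"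

lemma stopped_prod_Suc_eq_running_prod:
  "stopped_prod c y (Suc k) = stopped_prod c y k - running_prod c y k + running_prod c y k * y (Suc k)"
  by (simp add: running_prod_def)

lemma borel_measurable_stopped_prod:
  "{1..k} \<subseteq> I \<Longrightarrow> (\<lambda>y. stopped_prod c y k) \<in> borel_measurable (PiM I (\<lambda>_. borel))"
proof (induction k)
  case (Suc k)
  have [measurable]: "(\<lambda>y. stopped_prod c y k) \<in> borel_measurable (PiM I (\<lambda>_. borel))"
    using Suc by (intro Suc.IH) auto
  have [measurable]: "(\<lambda>y. y (Suc k)) \<in> borel_measurable (PiM I (\<lambda>_. borel :: real measure))"
    using Suc.prems by (intro measurable_component_singleton) auto
  show ?case unfolding stopped_prod.simps by measurable
qed simp

lemma borel_measurable_running_prod: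
  assumes "{1..k} \<subseteq> I"
  shows "(\<lambda>y. running_prod c y k) \<in> borel_measurable (PiM I (\<lambda>_. borel))"
proof -
  note [measurable] = borel_measurable_stopped_prod[OF assms]
  show ?thesis unfolding running_prod_def by measurable
qed

context prob_space
begin

lemma indep_var_restrict_component:
  assumes ind: "indep_vars M' X I" and "A \<subseteq> I" "i \<in> I" "i \<notin> A"
    and g: "g \<in> measurable (PiM A M') N"
  shows "indep_var N (\<lambda>\<omega>. g (\<lambda>j\<in>A. X j \<omega>)) (M' i) (X i)"
proof -
  have "indep_var (PiM A M') (\<lambda>\<omega>. \<lambda>j\<in>A. X j \<omega>) (PiM {i} M') (\<lambda>\<omega>. \<lambda>j\<in>{i}. X j \<omega>)"
    using assms by (intro indep_var_restrict[OF ind]) auto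
  moreover have "(\<lambda>y. y i) \<in> measurable (PiM {i} M') (M' i)"
    by (rule measurable_component_singleton) simp
  ultimately have "indep_var N (g \<circ> (\<lambda>\<omega>. \<lambda>j\<in>A. X j \<omega>)) (M' i) ((\<lambda>y. y i) \<circ> (\<lambda>\<omega>. \<lambda>j\<in>{i}. X j \<omega>))"
    using g by (intro indep_var_compose)
  thus ?thesis by (simp add: comp_def)
qed

context
  fixes Y :: "nat \<Rightarrow> 'a \<Rightarrow> real" and n :: nat
  assumes indep: "indep_vars (\<lambda>_. borel) Y {1..n}"
    and nonneg: "\<And>i \<omega>. i \<in> {1..n} \<Longrightarrow> \<omega> \<in> space M \<Longrightarrow> 0 \<le> Y i \<omega>"
    and integrable: "\<And>i. i \<in> {1..n} \<Longrightarrow> integrable M (Y i)"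
    and mean_le_1: "\<And>i. i \<in> {1..n} \<Longrightarrow> expectation (Y i) \<le> 1"
begin

lemma indep_var_running_prod:
  assumes "Suc k \<le> n"
  shows "indep_var borel (\<lambda>\<omega>. running_prod c (\<lambda>i. Y i \<omega>) k) borel (Y (Suc k))"
proof -
  have "indep_var borel (\<lambda>\<omega>. running_prod c (\<lambda>i\<in>{1..k}. Y i \<omega>) k) borel (Y (Suc k))"
    using assms by (intro indep_var_restrict_component[OF indep] borel_measurable_running_prod) auto
  moreover have "running_prod c (\<lambda>i\<in>{1..k}. Y i \<omega>) k = running_prod c (\<lambda>i. Y i \<omega>) k" for \<omega>
    using stopped_prod_cong[of k "\<lambda>i\<in>{1..k}. Y i \<omega>" "\<lambda>i. Y i \<omega>" c] by (simp add: running_prod_def)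
  ultimately show ?thesis by simp
qed

lemma integrable_running_prod:
  assumes "integrable M (\<lambda>\<omega>. stopped_prod c (\<lambda>i. Y i \<omega>) k)"
  shows "integrable M (\<lambda>\<omega>. running_prod c (\<lambda>i. Y i \<omega>) k)"
proof -
  note [measurable] = borel_measurable_integrable[OF assms]
  show ?thesis
    by (rule Bochner_Integration.integrable_bound[OF assms]) (auto simp: running_prod_def)
qed

lemma integrable_stopped_prod: "k \<le> n \<Longrightarrow> integrable M (\<lambda>\<omega>. stopped_prod c (\<lambda>i. Y i \<omega>) k)"
proof (induction k)
  case (Suc k)
  hence stopped: "integrable M (\<lambda>\<omega>. stopped_prod c (\<lambda>i. Y i \<omega>) k)" by simp
  note running = integrable_running_prod[OF stopped]
  have "integrable M (\<lambda>\<omega>. running_prod c (\<lambda>i. Y i \<omega>) k * Y (Suc k) \<omega>)"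
    using Suc.prems by (intro indep_var_integrable indep_var_running_prod running integrable) auto
  thus ?case
    unfolding stopped_prod_Suc_eq_running_prod using stopped running by auto
qed simp

lemma expectation_stopped_prod_le_1:
  "k \<le> n \<Longrightarrow> expectation (\<lambda>\<omega>. stopped_prod c (\<lambda>i. Y i \<omega>) k) \<le> 1"
proof (induction k)
  case 0
  show ?case by (simp add: prob_space)
next
  case (Suc k)
  let ?Z = "\<lambda>\<omega>. stopped_prod c (\<lambda>i. Y i \<omega>) k" and ?B = "\<lambda>\<omega>. running_prod c (\<lambda>i. Y i \<omega>) k"
  have Z_integrable: "integrable M ?Z" using Suc.prems by (intro integrable_stopped_prod) simp
  have B_integrable: "integrable M ?B" using Z_integrable by (rule integrable_running_prod)
  have Y_integrable: "integrable M (Y (Suc k))" and Y_mean: "expectation (Y (Suc k)) \<le> 1"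
    using integrable mean_le_1 Suc.prems by auto
  have B_nonneg: "0 \<le> expectation ?B"
    using nonneg Suc.prems unfolding running_prod_def
    by (intro Bochner_Integration.integral_nonneg) (auto intro!: stopped_prod_nonneg)
  note indep_B = indep_var_running_prod[OF Suc.prems]
  have "expectation (\<lambda>\<omega>. stopped_prod c (\<lambda>i. Y i \<omega>) (Suc k))
      = expectation ?Z - expectation ?B + expectation ?B * expectation (Y (Suc k))"
    unfolding stopped_prod_Suc_eq_running_prod
    using Z_integrable B_integrable indep_var_integrable[OF indep_B B_integrable Y_integrable]
      indep_var_lebesgue_integral[OF indep_B B_integrable Y_integrable]
    by simp
  also have "\<dots> \<le> expectation ?Z"
    using mult_left_mono[OF Y_mean B_nonneg] by simp
  also have "\<dots> \<le> 1"
    using Suc by simp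
  finally show ?case .
qed

lemma prob_prod_ge_le:
  assumes "0 < c"
  shows "prob {\<omega> \<in> space M. \<exists>k\<in>{1..n}. c \<le> (\<Prod>i=1..k. Y i \<omega>)} \<le> 1 / c"
proof -
  let ?Z = "\<lambda>\<omega>. stopped_prod c (\<lambda>i. Y i \<omega>) n"
  have Z: "integrable M ?Z" "expectation ?Z \<le> 1"
    by (simp_all add: integrable_stopped_prod expectation_stopped_prod_le_1)
  have [measurable]: "?Z \<in> borel_measurable M" using Z by auto
  have "prob {\<omega> \<in> space M. \<exists>k\<in>{1..n}. c \<le> (\<Prod>i=1..k. Y i \<omega>)} \<le> prob {\<omega> \<in> space M. c \<le> ?Z \<omega>}"
    using stopped_prod_ge_if_prod_ge[of c] by (intro finite_measure_mono) auto
  also have "\<dots> \<le> expectation ?Z / c"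
    using nonneg Z assms by (intro integral_Markov_inequality_measure[where A = "space M"])
      (auto intro!: stopped_prod_nonneg)
  also have "\<dots> \<le> 1 / c"
    using Z assms by (intro divide_right_mono) auto
  finally show ?thesis .
qed

end

end

section \<open>Time-uniform Bernstein bounds\<close>

lemma (in prob_space) exp_moment_le:
  fixes X :: "'a \<Rightarrow> real"
  assumes X [measurable]: "X \<in> borel_measurable M" and square: "integrable M (\<lambda>\<omega>. (X \<omega>)\<^sup>2)"
    and mean: "expectation X \<le> 0" and second_moment: "expectation (\<lambda>\<omega>. (X \<omega>)\<^sup>2) \<le> v"
    and bound: "AE \<omega> in M. X \<omega> \<le> b"
    and t: "0 \<le> t" "0 \<le> b" "t * b < 2"
  shows "integrable M (\<lambda>\<omega>. exp (t * X \<omega>))"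
    and "expectation (\<lambda>\<omega>. exp (t * X \<omega>)) \<le> exp (sub_gamma_psi b t * v)"
proof -
  let ?q = "\<lambda>\<omega>. 1 + t * X \<omega> + sub_gamma_psi b t * (X \<omega>)\<^sup>2"
  have X_integrable: "integrable M X"
    using X square by (rule square_integrable_imp_integrable)
  hence q_integrable: "integrable M ?q"
    using square by auto
  have exp_le_q: "AE \<omega> in M. exp (t * X \<omega>) \<le> ?q \<omega>"
    using bound
  proof eventually_elim
    case (elim \<omega>)
    have "t * X \<omega> \<le> t * b" using elim t by (intro mult_left_mono) auto
    from exp_le_quadratic[OF this] t show ?case
      by (simp add: sub_gamma_psi_def power_mult_distrib)
  qed
  show exp_integrable: "integrable M (\<lambda>\<omega>. exp (t * X \<omega>))"
  proof (rule Bochner_Integration.integrable_bound[OF q_integrable])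
    show "AE \<omega> in M. norm (exp (t * X \<omega>)) \<le> norm (?q \<omega>)"
      using exp_le_q by eventually_elim (smt (verit) exp_gt_zero real_norm_def)
  qed simp
  have "expectation (\<lambda>\<omega>. exp (t * X \<omega>)) \<le> expectation ?q"
    using exp_integrable q_integrable exp_le_q by (rule integral_mono_AE)
  also have "\<dots> = 1 + t * expectation X + sub_gamma_psi b t * expectation (\<lambda>\<omega>. (X \<omega>)\<^sup>2)"
    using X_integrable square by (simp add: prob_space)
  also have "\<dots> \<le> 1 + sub_gamma_psi b t * v"
    using mult_left_mono[OF second_moment sub_gamma_psi_nonneg[OF t(3)]] mult_left_mono[OF mean t(1)]
    by simp
  also have "\<dots> \<le> exp (sub_gamma_psi b t * v)"
    by (rule exp_ge_add_one_self)
  finally show "expectation (\<lambda>\<omega>. exp (t * X \<omega>)) \<le> exp (sub_gamma_psi b t * v)" .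
qed

locale bernstein_increments = prob_space M for M :: "'a measure" +
  fixes X :: "nat \<Rightarrow> 'a \<Rightarrow> real" and v :: "nat \<Rightarrow> real" and b :: real and n :: nat
  assumes indep: "indep_vars (\<lambda>_. borel) X {1..n}"
    and square_integrable: "\<And>i. i \<in> {1..n} \<Longrightarrow> integrable M (\<lambda>\<omega>. (X i \<omega>)\<^sup>2)"
    and mean_nonpos: "\<And>i. i \<in> {1..n} \<Longrightarrow> expectation (X i) \<le> 0"
    and second_moment_le: "\<And>i. i \<in> {1..n} \<Longrightarrow> expectation (\<lambda>\<omega>. (X i \<omega>)\<^sup>2) \<le> v i"
    and bounded_above: "\<And>i. i \<in> {1..n} \<Longrightarrow> AE \<omega> in M. X i \<omega> \<le> b"
    and bound_nonneg: "0 \<le> b"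
begin

lemma borel_measurable_increment: "i \<in> {1..n} \<Longrightarrow> X i \<in> borel_measurable M"
  using indep by (auto simp: indep_vars_def)

lemma borel_measurable_partial_sum:
  "k \<in> {1..n} \<Longrightarrow> (\<lambda>\<omega>. \<Sum>i=1..k. X i \<omega>) \<in> borel_measurable M"
  by (intro borel_measurable_sum borel_measurable_increment) auto

lemma sets_Collect_partial_sum_ge:
  "{\<omega> \<in> space M. \<exists>k\<in>{1..n}. Q k \<and> c k \<le> (\<Sum>i=1..k. X i \<omega>)} \<in> events"
  by (intro sets.sets_Collect_finite_Ex sets.sets_Collect_conj borel_measurable_le
      borel_measurable_partial_sum) auto

lemma prob_linear_crossing_le:
  assumes t: "0 \<le> t" "t * b < 2"
  shows "prob {\<omega> \<in> space M. \<exists>k\<in>{1..n}.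
    x \<le> t * (\<Sum>i=1..k. X i \<omega>) - sub_gamma_psi b t * (\<Sum>i=1..k. v i)} \<le> exp (- x)"
proof -
  define Y where "Y i \<omega> = exp (t * X i \<omega> - sub_gamma_psi b t * v i)" for i \<omega>
  have Y: "integrable M (Y i)" "expectation (Y i) \<le> 1" if "i \<in> {1..n}" for i
  proof -
    note increment = borel_measurable_increment[OF that] square_integrable[OF that]
      mean_nonpos[OF that] second_moment_le[OF that] bounded_above[OF that]
    note moment = exp_moment_le[OF increment t(1) bound_nonneg t(2)]
    show "integrable M (Y i)" unfolding Y_def exp_diff using moment by auto
    have "expectation (Y i) = expectation (\<lambda>\<omega>. exp (t * X i \<omega>)) / exp (sub_gamma_psi b t * v i)"
      unfolding Y_def exp_diff by simp
    also have "\<dots> \<le> 1" using moment by (simp add: divide_le_eq)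
    finally show "expectation (Y i) \<le> 1" .
  qed
  have indep_Y: "indep_vars (\<lambda>_. borel) Y {1..n}"
    unfolding Y_def by (rule indep_vars_compose2[OF indep]) auto
  have prod_Y: "(\<Prod>i=1..k. Y i \<omega>)
      = exp (t * (\<Sum>i=1..k. X i \<omega>) - sub_gamma_psi b t * (\<Sum>i=1..k. v i))" for k \<omega>
    unfolding Y_def by (simp add: exp_sum[symmetric] sum_subtractf sum_distrib_left)
  have "prob {\<omega> \<in> space M. \<exists>k\<in>{1..n}. exp x \<le> (\<Prod>i=1..k. Y i \<omega>)} \<le> 1 / exp x"
    by (rule prob_prod_ge_le[OF indep_Y _ Y]) (simp_all add: Y_def)
  thus ?thesis unfolding prod_Y exp_le_cancel_iff by (simp add: exp_minus inverse_eq_divide)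
qed

lemma prob_partial_sum_ge_bernstein_radius:
  assumes V_pos: "0 < V" and x_pos: "0 < x"
  shows "prob {\<omega> \<in> space M. \<exists>k\<in>{1..n}.
    (\<Sum>i=1..k. v i) \<le> V \<and> bernstein_radius b V x \<le> (\<Sum>i=1..k. X i \<omega>)} \<le> exp (- x)"
proof -
  obtain t where t_pos: "0 < t" and t_less: "t * b < 2"
    and optimal: "t * bernstein_radius b V x - V * sub_gamma_psi b t = x"
    using bernstein_radius_attained[OF bound_nonneg V_pos x_pos] .
  have crossing: "x \<le> t * S - sub_gamma_psi b t * W"
    if "W \<le> V" "bernstein_radius b V x \<le> S" for S W
    using optimal mult_left_mono[OF that(1) sub_gamma_psi_nonneg[OF t_less]]
      mult_left_mono[OF that(2) less_imp_le[OF t_pos]] by (simp add: mult.commute)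
  have "prob {\<omega> \<in> space M. \<exists>k\<in>{1..n}.
      (\<Sum>i=1..k. v i) \<le> V \<and> bernstein_radius b V x \<le> (\<Sum>i=1..k. X i \<omega>)}
    \<le> prob {\<omega> \<in> space M. \<exists>k\<in>{1..n}.
      x \<le> t * (\<Sum>i=1..k. X i \<omega>) - sub_gamma_psi b t * (\<Sum>i=1..k. v i)}"
  proof (rule finite_measure_mono)
    show "{\<omega> \<in> space M. \<exists>k\<in>{1..n}.
        x \<le> t * (\<Sum>i=1..k. X i \<omega>) - sub_gamma_psi b t * (\<Sum>i=1..k. v i)} \<in> events"
      by (intro sets.sets_Collect_finite_Ex borel_measurable_le borel_measurable_diff
          borel_measurable_times borel_measurable_partial_sum) auto
  qed (use crossing in blast)
  also have "\<dots> \<le> exp (- x)"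
    using t_pos t_less by (intro prob_linear_crossing_le) auto
  finally show ?thesis .
qed

end

section \<open>Stitching over dyadic ranges\<close>

lemma kappa_pos: "0 < kappa"
  by (simp add: kappa_def)

lemma eps_pos:
  assumes "0 < \<delta>" "\<delta> \<le> 1"
  shows "0 < eps \<delta> u"
proof -
  have "1 < (1 + kappa) / \<delta>"
    using assms kappa_pos by (simp add: field_simps)
  hence "0 < ln ((1 + kappa) / \<delta>)" by (rule ln_gt_zero)
  moreover have "0 \<le> ln (1 + log 2 (max u 1))" by (rule ln_ge_zero) simp
  ultimately show ?thesis unfolding eps_def by linarith
qed

lemma eps_mono:
  assumes "max u 1 \<le> max w 1"
  shows "eps \<delta> u \<le> eps \<delta> w"
proof -
  have "log 2 (max u 1) \<le> log 2 (max w 1)"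
    using assms by simp
  moreover have "0 \<le> log 2 (max u 1)" by simp
  ultimately have "ln (1 + log 2 (max u 1)) \<le> ln (1 + log 2 (max w 1))"
    by (intro ln_mono) linarith+
  thus ?thesis by (simp add: eps_def)
qed

lemma exp_minus_eps_power2:
  assumes "0 < \<delta>"
  shows "exp (- eps \<delta> (2 ^ j)) = \<delta> / (1 + kappa) * (1 / (real j + 1)\<^sup>2)"
proof -
  have "log 2 (max (2 ^ j) 1) = real j"
    by (simp add: max.absorb1 log_nat_power)
  hence "exp (eps \<delta> (2 ^ j)) = exp (ln ((1 + kappa) / \<delta>)) * exp (ln (1 + real j)) ^ 2"
    by (simp add: eps_def exp_add exp_double)
  also have "\<dots> = (1 + kappa) / \<delta> * (real j + 1)\<^sup>2"
    using kappa_pos assms by (simp add: exp_ln add.commute)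
  finally show ?thesis by (simp add: exp_minus)
qed

lemma exp_minus_eps_power2_sums:
  assumes "0 < \<delta>"
  shows "(\<lambda>j. exp (- eps \<delta> (2 ^ j))) sums (\<delta> / (1 + kappa) * kappa)"
proof -
  have "(\<lambda>j. 1 / (real j + 1)\<^sup>2) sums kappa"
    using inverse_squares_sums unfolding kappa_def by (simp add: add.commute)
  thus ?thesis
    unfolding exp_minus_eps_power2[OF assms] by (rule sums_mult)
qed

lemma bernstein_radius_le_Delta:
  assumes \<delta>: "0 < \<delta>" "\<delta> \<le> 1" and range: "2 ^ j \<le> max u 1" and bound: "b \<le> 1"
  shows "bernstein_radius b (2 ^ Suc j) (eps \<delta> (2 ^ j)) \<le> Delta \<delta> u"
proof -
  let ?e = "eps \<delta> (2 ^ j)"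
  have eps_le: "?e \<le> eps \<delta> u"
    using range by (intro eps_mono) simp
  have eps_gt_0: "0 < ?e" using \<delta> by (rule eps_pos)
  have "sqrt (2 * 2 ^ Suc j * ?e) = sqrt (2\<^sup>2 * (?e * 2 ^ j))"
    by (simp add: algebra_simps)
  also have "\<dots> = 2 * sqrt ?e * sqrt (2 ^ j)"
    by (simp add: real_sqrt_mult)
  also have "\<dots> \<le> 2 * sqrt (eps \<delta> u) * sqrt (max u 1)"
    using eps_le eps_gt_0 range by (intro mult_mono) auto
  finally have "sqrt (2 * 2 ^ Suc j * ?e) \<le> 2 * sqrt (eps \<delta> u) * sqrt (max u 1)" .
  moreover have "b * ?e \<le> eps \<delta> u"
    using mult_right_mono[OF bound less_imp_le[OF eps_gt_0]] eps_le by simp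
  ultimately show ?thesis
    by (simp add: bernstein_radius_def Delta_def)
qed

lemma ex_dyadic_range:
  fixes u :: real
  assumes "1 \<le> u"
  obtains j where "2 ^ j \<le> u" "u < 2 ^ Suc j"
proof -
  define j where "j = nat \<lfloor>log 2 u\<rfloor>"
  have "\<lfloor>log 2 u\<rfloor> = int j"
    using assms by (simp add: j_def)
  hence "2 powr real j \<le> u" "u < 2 powr real (Suc j)"
    using assms by (simp_all add: floor_log_eq_powr_iff add.commute)
  hence "2 ^ j \<le> u" "u < 2 ^ Suc j"
    by (simp_all only: powr_realpow zero_less_numeral)
  thus thesis by (rule that)
qed

lemma (in prob_space) prob_UNION_le_sums:
  assumes "range A \<subseteq> events" "\<And>j. prob (A j) \<le> f j" "f sums q"
  shows "prob (\<Union>j. A j) \<le> q"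
proof -
  have summable: "summable (\<lambda>j. prob (A j))"
    using assms by (intro summable_comparison_test'[OF sums_summable[OF assms(3)], of 0]) auto
  have "prob (\<Union>j. A j) \<le> (\<Sum>j. prob (A j))"
    using assms(1) summable by (rule finite_measure_subadditive_countably)
  also have "\<dots> \<le> (\<Sum>j. f j)"
    using assms by (intro suminf_le summable sums_summable[OF assms(3)])
  also have "\<dots> = q"
    using assms(3) by (rule sums_unique[symmetric])
  finally show ?thesis .
qed

lemma (in bernstein_increments) prob_partial_sum_ge_Delta_le:
  assumes \<delta>: "0 < \<delta>" "\<delta> \<le> 1" and bound: "b \<le> 1"
  shows "prob {\<omega> \<in> space M. \<exists>k\<in>{1..n}. Delta \<delta> (\<Sum>i=1..k. v i) \<le> (\<Sum>i=1..k. X i \<omega>)} \<le> \<delta>"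
proof -
  define A where "A j = {\<omega> \<in> space M. \<exists>k\<in>{1..n}. (\<Sum>i=1..k. v i) \<le> 2 ^ Suc j \<and>
      bernstein_radius b (2 ^ Suc j) (eps \<delta> (2 ^ j)) \<le> (\<Sum>i=1..k. X i \<omega>)}" for j
  have events_A: "range A \<subseteq> events"
    unfolding A_def by (intro image_subsetI sets_Collect_partial_sum_ge)
  have prob_A: "prob (A j) \<le> exp (- eps \<delta> (2 ^ j))" for j
    unfolding A_def using \<delta> by (intro prob_partial_sum_ge_bernstein_radius eps_pos) auto
  have cover: "{\<omega> \<in> space M. \<exists>k\<in>{1..n}. Delta \<delta> (\<Sum>i=1..k. v i) \<le> (\<Sum>i=1..k. X i \<omega>)} \<subseteq> (\<Union>j. A j)"
  proof safe
    fix \<omega> k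
    assume \<omega>: "\<omega> \<in> space M" and k: "k \<in> {1..n}"
      and crossing: "Delta \<delta> (\<Sum>i=1..k. v i) \<le> (\<Sum>i=1..k. X i \<omega>)"
    obtain j where range: "2 ^ j \<le> max (\<Sum>i=1..k. v i) 1" "max (\<Sum>i=1..k. v i) 1 < 2 ^ Suc j"
      using ex_dyadic_range[of "max (\<Sum>i=1..k. v i) 1"] by auto
    have "bernstein_radius b (2 ^ Suc j) (eps \<delta> (2 ^ j)) \<le> (\<Sum>i=1..k. X i \<omega>)"
      using bernstein_radius_le_Delta[OF \<delta> range(1) bound] crossing by linarith
    moreover have "(\<Sum>i=1..k. v i) \<le> 2 ^ Suc j" using range(2) by linarith
    ultimately show "\<omega> \<in> (\<Union>j. A j)" using \<omega> k unfolding A_def by blast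
  qed
  have "prob {\<omega> \<in> space M. \<exists>k\<in>{1..n}. Delta \<delta> (\<Sum>i=1..k. v i) \<le> (\<Sum>i=1..k. X i \<omega>)}
      \<le> prob (\<Union>j. A j)"
    using events_A by (intro finite_measure_mono cover) auto
  also have "\<dots> \<le> \<delta> / (1 + kappa) * kappa"
    by (rule prob_UNION_le_sums[OF events_A prob_A exp_minus_eps_power2_sums[OF \<delta>(1)]])
  also have "\<dots> \<le> \<delta>"
    using kappa_pos \<delta> by (simp add: field_simps)
  finally show ?thesis .
qed

section \<open>Increments over the true nulls\<close>

definition rejection_excess :: "real \<Rightarrow> real \<Rightarrow> real \<Rightarrow> real" where
  "rejection_excess s lam y = of_bool (y \<le> s) - s / (1 - lam) * of_bool (y > lam)"

definition null_excess :: "'i set \<Rightarrow> real \<Rightarrow> real \<Rightarrow> 'i \<Rightarrow> real \<Rightarrow> real" where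
  "null_excess H0 s lam i y = of_bool (i \<in> H0) * rejection_excess s lam y"

lemma borel_measurable_rejection_excess [measurable]: "rejection_excess s lam \<in> borel_measurable borel"
  unfolding rejection_excess_def by measurable

lemma borel_measurable_null_excess [measurable]: "null_excess H0 s lam i \<in> borel_measurable borel"
  unfolding null_excess_def by measurable

lemma null_excess_bounds:
  assumes "0 \<le> s" "lam < 1"
  shows "- (s / (1 - lam)) \<le> null_excess H0 s lam i y" "null_excess H0 s lam i y \<le> 1"
proof -
  have "0 \<le> s / (1 - lam)" using assms by simp
  thus "- (s / (1 - lam)) \<le> null_excess H0 s lam i y" "null_excess H0 s lam i y \<le> 1"
    by (auto simp: null_excess_def rejection_excess_def of_bool_def)
qed

lemma null_excess_square_le:
  assumes "0 \<le> s" "lam < 1"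
  shows "(null_excess H0 s lam i y)\<^sup>2 \<le> (1 + s / (1 - lam))\<^sup>2"
proof -
  have "0 \<le> s / (1 - lam)" using assms by simp
  hence "\<bar>null_excess H0 s lam i y\<bar> \<le> 1 + s / (1 - lam)"
    using null_excess_bounds[OF assms, of H0 i y] by linarith
  from power_mono[OF this, of 2] show ?thesis by simp
qed

lemma nu_nonneg: "0 \<le> s \<Longrightarrow> 0 \<le> lam \<Longrightarrow> lam < 1 \<Longrightarrow> 0 \<le> nu s lam"
  by (simp add: nu_def)

context
  fixes s lam :: real
  assumes s: "0 \<le> s" "s \<le> 1" and lam: "0 \<le> lam" "lam < 1"
begin

interpretation U: prob_space "uniform_measure lborel {0..1::real}"
  by (rule prob_space_uniform_measure) auto

lemma uniform_prob_threshold_sets: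
  "U.prob {..s} = s" "U.prob {lam<..} = 1 - lam" "U.prob {lam<..s} = max 0 (s - lam)"
proof -
  have "{0..1} \<inter> {..s} = {0..s}" "{0..1} \<inter> {lam<..} = {lam<..1}" "{0..1} \<inter> {lam<..s} = {lam<..s}"
    using s lam by auto
  thus "U.prob {..s} = s" "U.prob {lam<..} = 1 - lam" "U.prob {lam<..s} = max 0 (s - lam)"
    using s lam by (auto simp: max_def)
qed

lemma integral_rejection_excess_uniform: "U.expectation (rejection_excess s lam) = 0"
proof -
  have "rejection_excess s lam = (\<lambda>y. indicator {..s} y - s / (1 - lam) * indicator {lam<..} y)"
    by (simp add: rejection_excess_def indicator_def fun_eq_iff)
  hence "U.expectation (rejection_excess s lam) = U.prob {..s} - s / (1 - lam) * U.prob {lam<..}"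
    by (simp add: U.emeasure_eq_measure)
  thus ?thesis using lam unfolding uniform_prob_threshold_sets by simp
qed

lemma integral_rejection_excess_square_uniform_le:
  "U.expectation (\<lambda>y. (rejection_excess s lam y)\<^sup>2) \<le> nu s lam"
proof -
  define c where "c = s / (1 - lam)"
  have c_nonneg: "0 \<le> c" and c_mult: "c * (1 - lam) = s" using s lam by (simp_all add: c_def)
  have "(rejection_excess s lam y)\<^sup>2
      = indicator {..s} y + c\<^sup>2 * indicator {lam<..} y - 2 * c * indicator {lam<..s} y" for y
    by (auto simp: rejection_excess_def c_def[symmetric] indicator_def power2_eq_square algebra_simps)
  hence "U.expectation (\<lambda>y. (rejection_excess s lam y)\<^sup>2)
      = U.prob {..s} + c\<^sup>2 * U.prob {lam<..} - 2 * c * U.prob {lam<..s}"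
    by (simp add: U.emeasure_eq_measure)
  also have "\<dots> = s + c * (c * (1 - lam)) - 2 * c * max 0 (s - lam)"
    by (simp add: uniform_prob_threshold_sets power2_eq_square)
  also have "\<dots> = s + c * (s - 2 * max 0 (s - lam))"
    unfolding c_mult by (simp add: algebra_simps)
  also have "\<dots> \<le> s + c * min s lam"
    using c_nonneg by (intro add_left_mono mult_left_mono) (auto simp: max_def)
  also have "\<dots> = nu s lam"
    by (simp add: nu_def c_def algebra_simps)
  finally show ?thesis .
qed

end

lemma (in prob_space) indep_vars_reindex:
  assumes ind: "indep_vars M' X I" and inj: "inj_on f J" and img: "f ` J \<subseteq> I"
  shows "indep_vars (\<lambda>j. M' (f j)) (\<lambda>j. X (f j)) J"
proof -
  have "indep_vars (\<lambda>j. PiM {f j} M') (\<lambda>j \<omega>. \<lambda>i\<in>{f j}. X i \<omega>) J"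
    using inj img by (intro indep_vars_restrict[OF ind]) (auto simp: disjoint_family_on_def inj_on_def)
  hence "indep_vars (\<lambda>j. M' (f j)) (\<lambda>j \<omega>. (\<lambda>i\<in>{f j}. X i \<omega>) (f j)) J"
    by (rule indep_vars_compose2[where Y = "\<lambda>j y. y (f j)"])
      (rule measurable_component_singleton, simp)
  thus ?thesis by simp
qed

lemma (in prob_space) bernstein_increments_null_excess:
  fixes p :: "'i \<Rightarrow> 'a \<Rightarrow> real"
  assumes ind: "indep_vars (\<lambda>_. borel) p I"
    and \<sigma>: "inj_on \<sigma> {1..n}" "\<sigma> ` {1..n} \<subseteq> I"
    and uniform: "\<And>i. i \<in> H0 \<Longrightarrow> distr M lborel (p i) = uniform_measure lborel {0..1}"
    and s: "0 \<le> s" "s \<le> 1" and lam: "0 \<le> lam" "lam < 1"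
  shows "bernstein_increments M (\<lambda>i \<omega>. null_excess H0 s lam (\<sigma> i) (p (\<sigma> i) \<omega>)) (\<lambda>_. nu s lam) 1 n"
proof
  let ?X = "\<lambda>i \<omega>. null_excess H0 s lam (\<sigma> i) (p (\<sigma> i) \<omega>)"
  have "indep_vars (\<lambda>_. borel) (\<lambda>i. p (\<sigma> i)) {1..n}"
    using indep_vars_reindex[OF ind \<sigma>] .
  thus "indep_vars (\<lambda>_. borel) ?X {1..n}"
    by (rule indep_vars_compose2) simp
  fix i assume "i \<in> {1..n}"
  hence [measurable]: "p (\<sigma> i) \<in> borel_measurable M"
    using ind \<sigma>(2) by (auto simp: indep_vars_def image_subset_iff)
  show "integrable M (\<lambda>\<omega>. (?X i \<omega>)\<^sup>2)"
    using null_excess_square_le[OF s(1) lam(2), of H0 "\<sigma> i"]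
    by (intro integrable_const_bound[where B = "(1 + s / (1 - lam))\<^sup>2"]) auto
  have transfer: "expectation (\<lambda>\<omega>. f (p (\<sigma> i) \<omega>)) = integral\<^sup>L (uniform_measure lborel {0..1}) f"
    if "\<sigma> i \<in> H0" "f \<in> borel_measurable borel" for f :: "real \<Rightarrow> real"
    using integral_distr[of "p (\<sigma> i)" M lborel f] that by (simp add: uniform)
  show "expectation (?X i) \<le> 0"
    using transfer[of "rejection_excess s lam"] integral_rejection_excess_uniform[OF s lam]
    by (cases "\<sigma> i \<in> H0") (auto simp: null_excess_def)
  show "expectation (\<lambda>\<omega>. (?X i \<omega>)\<^sup>2) \<le> nu s lam"
    using transfer[of "\<lambda>y. (rejection_excess s lam y)\<^sup>2"] nu_nonneg[OF s(1) lam]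
      integral_rejection_excess_square_uniform_le[OF s lam]
    by (cases "\<sigma> i \<in> H0") (auto simp: null_excess_def power_mult_distrib)
  show "AE \<omega> in M. ?X i \<omega> \<le> 1"
    using null_excess_bounds(2)[OF s(1) lam(2)] by (intro AE_I2)
qed simp

section \<open>The false discovery proportion and its Freedman envelope\<close>

lemma card_rej_set_Int:
  assumes "inj_on \<sigma> {1..k}"
  shows "real (card (rej_set \<sigma> s x k \<inter> H)) = (\<Sum>i=1..k. of_bool (\<sigma> i \<in> H \<and> x (\<sigma> i) \<le> s))"
proof -
  have "rej_set \<sigma> s x k \<inter> H = \<sigma> ` {i\<in>{1..k}. \<sigma> i \<in> H \<and> x (\<sigma> i) \<le> s}"
    by (auto simp: rej_set_def)
  moreover have "inj_on \<sigma> {i\<in>{1..k}. \<sigma> i \<in> H \<and> x (\<sigma> i) \<le> s}"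
    using assms by (rule inj_on_subset) auto
  ultimately have "card (rej_set \<sigma> s x k \<inter> H) = card {i\<in>{1..k}. \<sigma> i \<in> H \<and> x (\<sigma> i) \<le> s}"
    by (simp add: card_image)
  thus ?thesis by (simp add: of_bool_def sum.If_cases Int_def)
qed

lemma card_rej_set:
  "inj_on \<sigma> {1..k} \<Longrightarrow> real (card (rej_set \<sigma> s x k)) = (\<Sum>i=1..k. of_bool (x (\<sigma> i) \<le> s))"
  using card_rej_set_Int[of \<sigma> k s x UNIV] by simp

lemma finite_rej_set: "finite (rej_set \<sigma> s x k)"
  by (rule finite_subset[of _ "\<sigma> ` {1..k}"]) (auto simp: rej_set_def)

lemma card_false_rejections_le:
  assumes inj: "inj_on \<sigma> {1..k}" and "0 \<le> s" "lam < 1"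
  shows "real (card (rej_set \<sigma> s x k \<inter> H0)) \<le>
    s / (1 - lam) * (\<Sum>i=1..k. of_bool (x (\<sigma> i) > lam)) +
    (\<Sum>i=1..k. null_excess H0 s lam (\<sigma> i) (x (\<sigma> i)))"
proof -
  have "real (card (rej_set \<sigma> s x k \<inter> H0)) \<le>
      (\<Sum>i=1..k. s / (1 - lam) * of_bool (x (\<sigma> i) > lam) + null_excess H0 s lam (\<sigma> i) (x (\<sigma> i)))"
    unfolding card_rej_set_Int[OF inj] using assms
    by (intro sum_mono) (auto simp: null_excess_def rejection_excess_def)
  thus ?thesis unfolding sum.distrib sum_distrib_left .
qed

lemma FDP_le_FDP_Freed:
  assumes inj: "inj_on \<sigma> {1..k}" and "0 \<le> s" "lam < 1"
    and excess: "(\<Sum>i=1..k. null_excess H0 s lam (\<sigma> i) (x (\<sigma> i))) \<le> Delta \<delta> (nu s lam * real k)"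
  shows "FDP H0 (rej_set \<sigma> s x k) \<le> FDP_Freed \<sigma> s \<delta> lam x k"
proof -
  let ?R = "rej_set \<sigma> s x k"
  define N where "N = s / (1 - lam) * (\<Sum>i=1..k. of_bool (x (\<sigma> i) > lam)) + Delta \<delta> (nu s lam * real k)"
  have Freed: "FDP_Freed \<sigma> s \<delta> lam x k = (if card ?R = 0 then 1 else min 1 (N / real (card ?R)))"
    unfolding FDP_Freed_def Let_def N_def card_rej_set[OF inj, symmetric] by simp
  have le_card: "card (?R \<inter> H0) \<le> card ?R"
    using finite_rej_set by (intro card_mono) auto
  have le_N: "real (card (?R \<inter> H0)) \<le> N"
    using card_false_rejections_le[OF assms(1-3), of x H0] excess unfolding N_def by linarith
  show ?thesis
  proof (cases "card ?R = 0")
    case True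
    thus ?thesis using le_card by (simp add: FDP_def Freed)
  next
    case False
    hence "FDP H0 ?R = real (card (?R \<inter> H0)) / real (card ?R)"
      by (simp add: FDP_def max_def)
    thus ?thesis using False le_card le_N by (simp add: Freed divide_right_mono)
  qed
qed

context
  fixes x :: "'a \<Rightarrow> nat \<Rightarrow> real" and M :: "'a measure" and \<sigma> :: "nat \<Rightarrow> nat" and k :: nat
  assumes x: "\<And>i. i \<in> {1..k} \<Longrightarrow> (\<lambda>\<omega>. x \<omega> (\<sigma> i)) \<in> borel_measurable M"
begin

lemma borel_measurable_sum_of_bool:
  assumes "\<And>i. Measurable.pred borel (P i)"
  shows "(\<lambda>\<omega>. \<Sum>i=1..k. of_bool (P i (x \<omega> (\<sigma> i))) :: real) \<in> borel_measurable M"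
proof (rule borel_measurable_sum)
  fix i assume "i \<in> {1..k}"
  note [measurable] = x[OF this] assms
  show "(\<lambda>\<omega>. of_bool (P i (x \<omega> (\<sigma> i))) :: real) \<in> borel_measurable M" by measurable
qed

lemma borel_measurable_FDP_rej_set:
  assumes "inj_on \<sigma> {1..k}"
  shows "(\<lambda>\<omega>. FDP H0 (rej_set \<sigma> s (x \<omega>) k)) \<in> borel_measurable M"
proof -
  have [measurable]: "(\<lambda>\<omega>. real (card (rej_set \<sigma> s (x \<omega>) k \<inter> H))) \<in> borel_measurable M" for H
    unfolding card_rej_set_Int[OF assms]
    by (rule borel_measurable_sum_of_bool[where P = "\<lambda>i y. \<sigma> i \<in> H \<and> y \<le> s"]) measurable
  from this[of UNIV] have [measurable]: "(\<lambda>\<omega>. real (card (rej_set \<sigma> s (x \<omega>) k))) \<in> borel_measurable M"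
    by simp
  show ?thesis unfolding FDP_def of_nat_max by measurable
qed

lemma borel_measurable_FDP_Freed:
  "(\<lambda>\<omega>. FDP_Freed \<sigma> s \<delta> lam (x \<omega>) k) \<in> borel_measurable M"
proof -
  have [measurable]: "(\<lambda>\<omega>. \<Sum>i=1..k. of_bool (x \<omega> (\<sigma> i) \<le> s) :: real) \<in> borel_measurable M"
    by (rule borel_measurable_sum_of_bool[where P = "\<lambda>_ y. y \<le> s"]) measurable
  have [measurable]: "(\<lambda>\<omega>. \<Sum>i=1..k. of_bool (lam < x \<omega> (\<sigma> i)) :: real) \<in> borel_measurable M"
    by (rule borel_measurable_sum_of_bool[where P = "\<lambda>_ y. lam < y"]) measurable
  show ?thesis unfolding FDP_Freed_def Let_def by measurable
qed

end

theorem theorem18: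
  fixes M :: "'a measure" and p :: "nat \<Rightarrow> 'a \<Rightarrow> real" and m :: nat
    and H0 :: "nat set" and \<sigma> :: "nat \<Rightarrow> nat" and s \<delta> lam :: real
  assumes "prob_space M"
    and "prob_space.indep_vars M (\<lambda>_. borel) p {1..m}"
    and "\<And>i \<omega>. i \<in> {1..m} \<Longrightarrow> \<omega> \<in> space M \<Longrightarrow> p i \<omega> \<in> {0..1}"
    and "H0 \<subseteq> {1..m}"
    and "\<And>i. i \<in> H0 \<Longrightarrow> distr M lborel (p i) = uniform_measure lborel {0..1}"
    and "\<sigma> permutes {1..m}"
    and "s \<in> {0<..1}" and "\<delta> \<in> {0<..<1}" and "lam \<in> {0..<1}"
  shows "measure M {\<omega> \<in> space M. \<forall>k\<in>{1..m}.
           FDP H0 (rej_set \<sigma> s (\<lambda>i. p i \<omega>) k) \<le> FDP_Freed \<sigma> s \<delta> lam (\<lambda>i. p i \<omega>) k} \<ge> 1 - \<delta>"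
proof -
  interpret prob_space M by fact
  let ?p = "\<lambda>\<omega> i. p i \<omega>"
  have s: "0 \<le> s" "s \<le> 1" and \<delta>: "0 < \<delta>" "\<delta> \<le> 1" and lam: "0 \<le> lam" "lam < 1"
    using assms by auto
  have inj: "inj_on \<sigma> A" for A
    using permutes_inj[OF assms(6)] by (rule inj_on_subset) auto
  interpret bernstein_increments M "\<lambda>i \<omega>. null_excess H0 s lam (\<sigma> i) (p (\<sigma> i) \<omega>)" "\<lambda>_. nu s lam" 1 m
    using assms(2,5) permutes_image[OF assms(6)] inj s lam
    by (intro bernstein_increments_null_excess) auto
  let ?bad = "{\<omega> \<in> space M. \<exists>k\<in>{1..m}. Delta \<delta> (\<Sum>i=1..k. nu s lam) \<le>
    (\<Sum>i=1..k. null_excess H0 s lam (\<sigma> i) (p (\<sigma> i) \<omega>))}"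
  let ?good = "{\<omega> \<in> space M. \<forall>k\<in>{1..m}. FDP H0 (rej_set \<sigma> s (?p \<omega>) k) \<le> FDP_Freed \<sigma> s \<delta> lam (?p \<omega>) k}"
  have p_measurable: "p (\<sigma> i) \<in> borel_measurable M" if "i \<in> {1..m}" for i
    using assms(2) permutes_in_image[OF assms(6)] that by (auto simp: indep_vars_def)
  have "?good \<in> events"
    by (intro sets.sets_Collect_finite_All borel_measurable_le
        borel_measurable_FDP_rej_set borel_measurable_FDP_Freed inj p_measurable) auto
  moreover have "space M - ?bad \<subseteq> ?good"
    using FDP_le_FDP_Freed[OF inj s(1) lam(2)] by (force simp: mult.commute)
  ultimately have "prob (space M - ?bad) \<le> prob ?good" by (intro finite_measure_mono)
  moreover have "?bad \<in> events" using sets_Collect_partial_sum_ge[of "\<lambda>_. True"] by simp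
  ultimately show ?thesis
    using prob_compl[of ?bad] prob_partial_sum_ge_Delta_le[OF \<delta>] by simp
qed

end
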